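(* The normalized Kauffman bracket polynomial of virtual link diagrams is invariant under the Flype move: if $K$ and $K'$ are oriented virtual link diagrams related by a Flype move, then $f_K(A)=f_{K'}(A)$.
   Context: A virtual link diagram is a planar link diagram which besides classical crossings may have virtual crossings (neither over nor under). Bracket. The Kauffman bracket $\langle K\rangle\in\mathbb{Z}[A,A^{-1}]$ of a virtual link diagram $K$ is obtained by smoothing every classical crossing in both ways, with coefficient $A$ for an $A$-smoothing and $A^{-1}$ for a $B$-smoothing, and evaluating each resulting collection of $n$ closed curves (possibly with virtual crossings among them) as $(-A^2-A^{-2})^{n}$. (The $A$-smoothing joins the two regions swept out when the overstrand is turned counterclockwise towards the understrand; virtual crossings are left as they are.) Normalized bracket. For an oriented virtual link diagram $K$ with writhe $w(K)$ (sum of the signs of its classical crossings), $$f_K(A)=\frac{(-A^{3})^{-w(K)}}{-A^2-A^{-2}}\,\langle K\rangle .$$ Flype move. Locally, consider two strands which form a classical crossing $\sigma$ followed (stacked vertically) by a virtual crossing $v$. The Flype move replaces this two-strand tangle $\sigma v$ by $v\sigma$: the virtual crossing first and then the same classical crossing $\sigma$ (as a braid-type crossing in the plane, so that its oriented sign is unchanged). The inverse replacement is also a Flype move. *)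

theory Defs
  imports
    "HOL-Library.Numeral_Type"
    "HOL-Library.Poly_Mapping"
    "HOL-Computational_Algebra.Fraction_Field"
begin

section \<open>Oriented virtual link diagrams\<close>

text \<open>
  A diagram is given by its planar diagram code.  The four ends of a crossing \<open>c\<close> are
  \<open>(c, 0), (c, 1), (c, 2), (c, 3)\<close>, listed counterclockwise, so that the two strands through
  \<open>c\<close> are \<open>0 - 2\<close> and \<open>1 - 3\<close>.  At a classical crossing \<open>0 - 2\<close> is the understrand and
  \<open>1 - 3\<close> is the overstrand.  The arcs of the diagram are recorded by the involution \<open>mate\<close>,
  which sends each end to the other end of its arc.  An end belongs to \<open>outs\<close> if
  the orientation leaves the crossing there.  Closed components without any crossing are not
  visible in this data; their number is \<open>free_circles\<close>.
\<close>

type_synonym 'c dart = "'c \<times> 4"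

record 'c vlink =
  crossings :: "'c set"
  virtuals :: "'c set"
  mate :: "'c dart \<Rightarrow> 'c dart"
  outs :: "'c dart set"
  free_circles :: nat

definition classicals :: "'c vlink \<Rightarrow> 'c set" where
  "classicals K = crossings K - virtuals K"

definition darts :: "'c vlink \<Rightarrow> 'c dart set" where
  "darts K = crossings K \<times> UNIV"

definition turn :: "4 \<Rightarrow> 'c dart \<Rightarrow> 'c dart" where
  "turn k d = (fst d, snd d + k)"

text \<open>
  The number of orbits on \<open>D\<close> of the group generated by the maps in \<open>F\<close>, which will always be
  permutations of the finite set \<open>D\<close>; hence reachability is already symmetric.
\<close>

definition orbit_count :: "'a set \<Rightarrow> ('a \<Rightarrow> 'a) set \<Rightarrow> nat" where
  "orbit_count D F = card (D // {(x, f x) | x f. x \<in> D \<and> f \<in> F}\<^sup>*)"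

text \<open>
  The diagram lies in the plane iff every connected component of the underlying 4-valent
  graph, with its counterclockwise order of ends, has Euler characteristic
  \<open>V - E + F = 2\<close>.  This value is at most 2 for each component, so it suffices to add up
  over all components.
\<close>

definition planar :: "'c vlink \<Rightarrow> bool" where
  "planar K \<longleftrightarrow>
     int (card (crossings K))
     - int (orbit_count (darts K) {mate K})
     + int (orbit_count (darts K) {turn 1 \<circ> mate K})
     = 2 * int (orbit_count (darts K) {mate K, turn 1})"

definition virtual_link_diagram :: "'c vlink \<Rightarrow> bool" where
  "virtual_link_diagram K \<longleftrightarrow>
     finite (crossings K) \<and> virtuals K \<subseteq> crossings K \<and> outs K \<subseteq> darts K \<and>
     (\<forall>d \<in> darts K. mate K d \<in> darts K \<and> mate K d \<noteq> d \<and> mate K (mate K d) = d) \<and>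
     (\<forall>d \<in> darts K. mate K d \<in> outs K \<longleftrightarrow> d \<notin> outs K) \<and>
     (\<forall>d \<in> darts K. turn 2 d \<in> outs K \<longleftrightarrow> d \<notin> outs K) \<and>
     planar K"

section \<open>The bracket\<close>

text \<open>
  Laurent polynomials \<open>\<int>[A, A\<inverse>]\<close> are the finitely supported functions from exponents to
  coefficients.
\<close>

type_synonym laurent = "int \<Rightarrow>\<^sub>0 int"

definition A_pow :: "int \<Rightarrow> laurent" where
  "A_pow n = Poly_Mapping.single n 1"

definition delta :: laurent where
  "delta = - A_pow 2 - A_pow (- 2)"

text \<open>
  Turning the overstrand \<open>1 - 3\<close> counterclockwise sweeps out the region between ends \<open>1\<close>
  and \<open>2\<close> and the region between ends \<open>3\<close> and \<open>0\<close>.  Joining these two regions connects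
  \<open>0\<close> with \<open>1\<close> and \<open>2\<close> with \<open>3\<close>.
\<close>

definition A_smooth :: "4 \<Rightarrow> 4" where
  "A_smooth i = (if i = 0 then 1 else if i = 1 then 0 else if i = 2 then 3 else 2)"

definition B_smooth :: "4 \<Rightarrow> 4" where
  "B_smooth i = (if i = 0 then 3 else if i = 3 then 0 else if i = 1 then 2 else 1)"

text \<open>A state is the set \<open>S\<close> of those classical crossings that receive the A-smoothing.\<close>

definition state_join :: "'c vlink \<Rightarrow> 'c set \<Rightarrow> 'c dart \<Rightarrow> 'c dart" where
  "state_join K S d =
     (if fst d \<in> virtuals K then turn 2 d
      else if fst d \<in> S then (fst d, A_smooth (snd d))
      else (fst d, B_smooth (snd d)))"

definition state_curves :: "'c vlink \<Rightarrow> 'c set \<Rightarrow> nat" where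
  "state_curves K S = orbit_count (darts K) {mate K, state_join K S} + free_circles K"

definition bracket :: "'c vlink \<Rightarrow> laurent" where
  "bracket K = (\<Sum>S \<in> Pow (classicals K).
     A_pow 1 ^ card S * A_pow (- 1) ^ card (classicals K - S) * delta ^ state_curves K S)"

text \<open>
  A crossing is positive iff the pair (over direction, under direction) is positively oriented.
  If the understrand leaves through \<open>2\<close>, this means that the overstrand leaves through \<open>1\<close>.
\<close>

definition crossing_sign :: "'c vlink \<Rightarrow> 'c \<Rightarrow> int" where
  "crossing_sign K c = (if (c, 1) \<in> outs K \<longleftrightarrow> (c, 2) \<in> outs K then 1 else - 1)"

definition writhe :: "'c vlink \<Rightarrow> int" where
  "writhe K = (\<Sum>c \<in> classicals K. crossing_sign K c)"

text \<open>
  The division is carried out in the fraction field of \<open>\<int>[A, A\<inverse>]\<close>; only for the empty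
  diagram is the result not a Laurent polynomial.
\<close>

definition of_laurent :: "laurent \<Rightarrow> laurent fract" where
  "of_laurent p = Fraction_Field.Fract p 1"

definition normalized_bracket :: "'c vlink \<Rightarrow> laurent fract" where
  "normalized_bracket K =
     (- of_laurent (A_pow 3)) powi (- writhe K) / of_laurent delta * of_laurent (bracket K)"

section \<open>The Flype move\<close>

text \<open>
  The two-strand tangle has the classical crossing \<open>c\<close> on top and the virtual crossing \<open>v\<close>
  below it.  Counterclockwise from top left (top left, bottom left, bottom right, top right),
  the ends of \<open>c\<close> are \<open>r, r + 1, r + 2, r + 3\<close> and those of \<open>v\<close> are
  \<open>s, s + 1, s + 2, s + 3\<close>; the parity of \<open>r\<close> decides which strand of \<open>c\<close> is over.
\<close>

definition stacked :: "'c vlink \<Rightarrow> 'c \<Rightarrow> 4 \<Rightarrow> 'c \<Rightarrow> 4 \<Rightarrow> bool" where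
  "stacked K c r v s \<longleftrightarrow>
     c \<in> classicals K \<and> v \<in> virtuals K \<and>
     mate K (c, r + 1) = (v, s) \<and> mate K (c, r + 2) = (v, s + 3)"

text \<open>
  The positions of \<open>c\<close> and \<open>v\<close> in the plane are exchanged without rotating either of them:
  an arc that ended at, say, the top left end of one now ends at the top left end
  of the other.  Orientations are carried along with the arcs.
\<close>

definition exchange :: "'c \<Rightarrow> 4 \<Rightarrow> 'c \<Rightarrow> 4 \<Rightarrow> 'c dart \<Rightarrow> 'c dart" where
  "exchange c r v s d =
     (if fst d = c then (v, snd d - r + s)
      else if fst d = v then (c, snd d - s + r)
      else d)"

definition flype_step :: "'c vlink \<Rightarrow> 'c vlink \<Rightarrow> bool" where
  "flype_step K K' \<longleftrightarrow>
     (\<exists>c r v s. stacked K c r v s \<and>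
        K' = K\<lparr>mate := exchange c r v s \<circ> mate K \<circ> exchange c r v s,
               outs := exchange c r v s ` outs K\<rparr>)"

text \<open>
  Codes of the same diagram differ by renaming crossings and by the choice of the end numbered
  0.  At a classical crossing the latter must keep the overstrand over.
\<close>

definition same_diagram :: "'c vlink \<Rightarrow> 'd vlink \<Rightarrow> bool" where
  "same_diagram K K' \<longleftrightarrow>
     (\<exists>g k. bij_betw g (crossings K) (crossings K') \<and>
        g ` virtuals K = virtuals K' \<and>
        (\<forall>c \<in> classicals K. k c \<in> {0, 2}) \<and>
        (\<forall>(c, i) \<in> darts K. \<forall>(c', i') \<in> darts K.
           mate K (c, i) = (c', i') \<longleftrightarrow> mate K' (g c, i + k c) = (g c', i' + k c')) \<and>
        (\<forall>(c, i) \<in> darts K. (c, i) \<in> outs K \<longleftrightarrow> (g c, i + k c) \<in> outs K') \<and>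
        free_circles K = free_circles K')"

definition flype :: "'c vlink \<Rightarrow> 'd vlink \<Rightarrow> bool" where
  "flype K K' \<longleftrightarrow>
     (\<exists>L. (flype_step K L \<or> flype_step L K) \<and> same_diagram L K')"

end

theory Submission
  imports Defs
begin

text \<open>
  The bracket is invariant state by state.  In every smoothing of the classical crossing the
  tangles \<open>\<sigma> v\<close> and \<open>v \<sigma>\<close> connect their four outer ends in the same way, and neither of them
  contains a closed curve, since every inner end is joined to an outer one; so both states have
  equally many curves.  The crossing \<open>\<sigma>\<close> keeps its sign because the two strands that run
  through it merely exchange their roles.
\<close>

section \<open>Counting orbits\<close>

text \<open>Each generating pair can be run backwards with the same map. Reachability is therefore
  an equivalence relation and its classes are true orbits.\<close>

lemma sym_rtrancl_involutions:
  assumes "\<And>x f. x \<in> D \<Longrightarrow> f \<in> F \<Longrightarrow> f x \<in> D \<and> f (f x) = x"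
  shows "sym ({(x, f x) | x f. x \<in> D \<and> f \<in> F}\<^sup>*)"
proof (rule sym_rtrancl, rule symI)
  fix a b assume "(a, b) \<in> {(x, f x) | x f. x \<in> D \<and> f \<in> F}"
  then obtain f where "a \<in> D" "f \<in> F" "b = f a" by auto
  with assms[of a f] show "(b, a) \<in> {(x, f x) | x f. x \<in> D \<and> f \<in> F}"
    by (auto intro!: exI[of _ b] exI[of _ f])
qed

text \<open>By \<open>hom\<close>, \<open>h\<close> carries orbits into orbits, so it induces a map
  from the orbits of \<open>F\<close> to those of \<open>F'\<close>; by \<open>surj\<close> this map
  is onto. Working only up to reachability lets \<open>h\<close> collapse several points of an orbit
  into one, as is done below for the inner ends of a tangle.\<close>

lemma orbit_count_le:
  fixes h :: "'a \<Rightarrow> 'b"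
  assumes fin: "finite D"
    and inv: "\<And>y f. y \<in> D' \<Longrightarrow> f \<in> F' \<Longrightarrow> f y \<in> D' \<and> f (f y) = y"
    and hom: "\<And>x f. x \<in> D \<Longrightarrow> f \<in> F \<Longrightarrow> (h x, h (f x)) \<in> {(y, f y) | y f. y \<in> D' \<and> f \<in> F'}\<^sup>*"
    and surj: "\<And>y. y \<in> D' \<Longrightarrow> \<exists>x\<in>D. (h x, y) \<in> {(y, f y) | y f. y \<in> D' \<and> f \<in> F'}\<^sup>*"
  shows "orbit_count D' F' \<le> orbit_count D F"
proof -
  define R where "R = {(x, f x) | x f. x \<in> D \<and> f \<in> F}"
  define R' where "R' = {(y, f y) | y f. y \<in> D' \<and> f \<in> F'}"
  have symR': "sym (R'\<^sup>*)"
    unfolding R'_def by (rule sym_rtrancl_involutions) (use inv in auto)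
  have homs: "(h x, h y) \<in> R'\<^sup>*" if "(x, y) \<in> R\<^sup>*" for x y
    using that
  proof induction
    case (step y z)
    then have "(h y, h z) \<in> R'\<^sup>*"
      using hom by (auto simp: R_def R'_def)
    with step.IH show ?case by (rule rtrancl_trans)
  qed simp
  \<comment> \<open>The induced map on orbits sends \<open>X\<close> to the closure of its image
    under \<open>h\<close>; on the orbit of \<open>x\<close> it gives the orbit of
    \<open>h x\<close>.\<close>
  have cls: "R'\<^sup>* `` (h ` (R\<^sup>* `` {x})) = R'\<^sup>* `` {h x}" for x
    using homs by (auto intro: rtrancl_trans)
  have "D' // R'\<^sup>* \<subseteq> (\<lambda>X. R'\<^sup>* `` (h ` X)) ` (D // R\<^sup>*)"
  proof
    fix Y assume "Y \<in> D' // R'\<^sup>*"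
    then obtain y where y: "y \<in> D'" "Y = R'\<^sup>* `` {y}" by (auto elim: quotientE)
    from surj[OF y(1)] obtain x where x: "x \<in> D" "(h x, y) \<in> R'\<^sup>*" by (auto simp: R'_def)
    then have "(y, h x) \<in> R'\<^sup>*" using symR' by (auto dest: symD)
    with x(2) have "Y = R'\<^sup>* `` {h x}" unfolding y(2) by (auto intro: rtrancl_trans)
    then have "Y = R'\<^sup>* `` (h ` (R\<^sup>* `` {x}))" by (simp only: cls)
    then show "Y \<in> (\<lambda>X. R'\<^sup>* `` (h ` X)) ` (D // R\<^sup>*)"
      using x(1) by (blast intro: quotientI)
  qed
  moreover have "finite (D // R\<^sup>*)"
    using fin by (auto simp: quotient_def)
  ultimately have "card (D' // R'\<^sup>*) \<le> card (D // R\<^sup>*)"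
    using surj_card_le by blast
  then show ?thesis by (simp add: orbit_count_def R_def R'_def)
qed

text \<open>Both \<open>h\<close> and its inverse satisfy the conditions of
  \<open>orbit_count_le\<close>. This serves for renaming crossings, where the arcs and joins
  correspond exactly.\<close>

lemma orbit_count_bij_betw:
  assumes fin: "finite D" and bij: "bij_betw h D D'"
    and m: "\<And>x. x \<in> D \<Longrightarrow> m x \<in> D \<and> m (m x) = x"
    and j: "\<And>x. x \<in> D \<Longrightarrow> j x \<in> D \<and> j (j x) = x"
    and hm: "\<And>x. x \<in> D \<Longrightarrow> h (m x) = m' (h x)"
    and hj: "\<And>x. x \<in> D \<Longrightarrow> h (j x) = j' (h x)"
  shows "orbit_count D {m, j} = orbit_count D' {m', j'}"
proof (rule antisym)
  define i where "i = inv_into D h"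
  have D': "D' = h ` D" using bij by (simp add: bij_betw_def)
  have ih: "i (h x) = x" if "x \<in> D" for x
    using that bij by (simp add: i_def bij_betw_inv_into_left)
  show "orbit_count D {m, j} \<le> orbit_count D' {m', j'}"
  proof (rule orbit_count_le[where h = i])
    show "finite D'" using fin D' by simp
  next
    fix y f assume "y \<in> D" "f \<in> {m, j}"
    then show "f y \<in> D \<and> f (f y) = y" using m j by auto
  next
    fix x f assume "x \<in> D'" "f \<in> {m', j'}"
    then obtain d where d: "d \<in> D" "x = h d" using D' by auto
    with \<open>f \<in> {m', j'}\<close> have "f x = h (m d) \<or> f x = h (j d)"
      using hm hj by auto
    then have "i (f x) = m (i x) \<or> i (f x) = j (i x)"
      using d m j ih by auto
    then show "(i x, i (f x)) \<in> {(y, f y) | y f. y \<in> D \<and> f \<in> {m, j}}\<^sup>*"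
      using d ih by (intro r_into_rtrancl) auto
  next
    fix y assume "y \<in> D"
    then show "\<exists>x\<in>D'. (i x, y) \<in> {(y, f y) | y f. y \<in> D \<and> f \<in> {m, j}}\<^sup>*"
      using D' ih by (intro bexI[of _ "h y"]) auto
  qed
  show "orbit_count D' {m', j'} \<le> orbit_count D {m, j}"
  proof (rule orbit_count_le[where h = h])
    fix y f assume "y \<in> D'" "f \<in> {m', j'}"
    then obtain d where d: "d \<in> D" "y = h d" using D' by auto
    have "m' y = h (m d)" "m' (h (m d)) = h d" "j' y = h (j d)" "j' (h (j d)) = h d"
      using d hm[of d] hm[of "m d"] hj[of d] hj[of "j d"] m j by auto
    then show "f y \<in> D' \<and> f (f y) = y"
      using \<open>f \<in> {m', j'}\<close> d m j D' by auto
  next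
    fix x f assume "x \<in> D" "f \<in> {m, j}"
    then show "(h x, h (f x)) \<in> {(y, f y) | y f. y \<in> D' \<and> f \<in> {m', j'}}\<^sup>*"
      using hm hj D' by (intro r_into_rtrancl) auto
  next
    fix y assume "y \<in> D'"
    then show "\<exists>x\<in>D. (h x, y) \<in> {(y, f y) | y f. y \<in> D' \<and> f \<in> {m', j'}}\<^sup>*"
      using D' by auto
  qed (fact fin)
qed

section \<open>Smoothings\<close>

lemma exhaust_four: "(i::4) = 0 \<or> i = 1 \<or> i = 2 \<or> i = 3"
proof (induction i)
  case (of_int z)
  then have "z = 0 \<or> z = 1 \<or> z = 2 \<or> z = 3" by (simp, arith)
  then show ?case by auto
qed

lemma mod_four: "(4::4) = 0" "(5::4) = 1" "(6::4) = 2"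
  by simp_all

lemma smooth_involution [simp]: "A_smooth (A_smooth i) = i" "B_smooth (B_smooth i) = i"
  using exhaust_four[of i] by (auto simp: A_smooth_def B_smooth_def)

text \<open>A half turn preserves the two regions that a smoothing joins. Hence renumbering the ends
  of a classical crossing by 0 or 2 respects both smoothings.\<close>

lemma smooth_half_turn:
  "A_smooth (i + 2) = A_smooth i + 2" "B_smooth (i + 2) = B_smooth i + 2"
  using exhaust_four[of i] by (auto simp: A_smooth_def B_smooth_def)

text \<open>With \<open>r\<close> as the top left end and counterclockwise numbering, the two left
  ends are joined and the two right ends are joined; \<open>horizontal\<close> joins the two top
  ends and the two bottom ends.\<close>

definition vertical :: "(4 \<Rightarrow> 4) \<Rightarrow> 4 \<Rightarrow> bool" where
  "vertical \<sigma> r \<longleftrightarrow> \<sigma> r = r + 1 \<and> \<sigma> (r + 1) = r \<and> \<sigma> (r + 2) = r + 3 \<and> \<sigma> (r + 3) = r + 2"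

definition horizontal :: "(4 \<Rightarrow> 4) \<Rightarrow> 4 \<Rightarrow> bool" where
  "horizontal \<sigma> r \<longleftrightarrow> \<sigma> r = r + 3 \<and> \<sigma> (r + 3) = r \<and> \<sigma> (r + 1) = r + 2 \<and> \<sigma> (r + 2) = r + 1"

text \<open>The parity of \<open>r\<close> decides which case occurs. Thus two planar pictures cover
  both smoothings and both choices of the overstrand.\<close>

lemma smooth_cases:
  "vertical A_smooth r \<or> horizontal A_smooth r" "vertical B_smooth r \<or> horizontal B_smooth r"
  using exhaust_four[of r]
  by (auto simp: A_smooth_def B_smooth_def vertical_def horizontal_def)

lemma state_join_involution:
  assumes "d \<in> darts K"
  shows "state_join K S d \<in> darts K \<and> state_join K S (state_join K S d) = d"
  using assms by (cases d) (auto simp: state_join_def turn_def darts_def algebra_simps)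

section \<open>The Flype move\<close>

text \<open>
  The code \<open>L\<close> between \<open>K\<close> and \<open>K'\<close> in \<open>flype\<close> is not assumed to be a diagram; this is the
  part of being a diagram that it inherits from \<open>K\<close>.
\<close>

definition matched :: "'c vlink \<Rightarrow> bool" where
  "matched K \<longleftrightarrow> finite (crossings K) \<and> virtuals K \<subseteq> crossings K \<and>
     (\<forall>d \<in> darts K. mate K d \<in> darts K \<and> mate K (mate K d) = d)"

definition flyped :: "'c \<Rightarrow> 4 \<Rightarrow> 'c \<Rightarrow> 4 \<Rightarrow> 'c vlink \<Rightarrow> 'c vlink" where
  "flyped c r v s K = K\<lparr>mate := exchange c r v s \<circ> mate K \<circ> exchange c r v s,
                        outs := exchange c r v s ` outs K\<rparr>"

text \<open>The move reroutes arcs and orientations but keeps the names and types of all crossings,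
  so a state is smoothed by literally the same map before and after.\<close>

lemma flyped_simps [simp]:
  "crossings (flyped c r v s K) = crossings K"
  "virtuals (flyped c r v s K) = virtuals K"
  "classicals (flyped c r v s K) = classicals K"
  "darts (flyped c r v s K) = darts K"
  "free_circles (flyped c r v s K) = free_circles K"
  "mate (flyped c r v s K) d = exchange c r v s (mate K (exchange c r v s d))"
  "outs (flyped c r v s K) = exchange c r v s ` outs K"
  "state_join (flyped c r v s K) S = state_join K S"
  by (simp_all add: flyped_def classicals_def darts_def state_join_def fun_eq_iff)

lemma exchange_involution:
  "c \<noteq> v \<Longrightarrow> exchange c r v s (exchange c r v s d) = d"
  by (cases d) (auto simp: exchange_def)

lemma exchange_in_darts:
  "c \<in> crossings K \<Longrightarrow> v \<in> crossings K \<Longrightarrow> d \<in> darts K \<Longrightarrow> exchange c r v s d \<in> darts K"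
  by (cases d) (auto simp: exchange_def darts_def)

lemma flyped_flyped:
  assumes "c \<noteq> v" shows "flyped c r v s (flyped c r v s K) = K"
proof -
  have "exchange c r v s (exchange c r v s d) = d" for d
    by (rule exchange_involution[OF assms])
  then show ?thesis
    by (simp add: flyped_def image_image o_def)
qed

lemma matched_flyped:
  assumes "matched K" "c \<in> crossings K" "v \<in> crossings K" "c \<noteq> v"
  shows "matched (flyped c r v s K)"
  using assms exchange_in_darts[OF assms(2,3)]
  by (auto simp: matched_def exchange_involution)

text \<open>A Flype move is undone by the Flype move of the same tangle seen upside down.\<close>

lemma stacked_flyped:
  assumes "matched K" "stacked K c r v s"
  shows "stacked (flyped c r v s K) c (r + 2) v (s + 2)"
    and "exchange c (r + 2) v (s + 2) = exchange c r v s"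
proof -
  have cv: "c \<noteq> v" "c \<in> crossings K" and m: "mate K (c, r + 1) = (v, s)" "mate K (c, r + 2) = (v, s + 3)"
    using assms(2) by (auto simp: stacked_def classicals_def)
  have "(c, i) \<in> darts K" for i using cv by (simp add: darts_def)
  then have "mate K (v, s) = (c, r + 1)" "mate K (v, s + 3) = (c, r + 2)"
    using assms(1) m unfolding matched_def by metis+
  then show "stacked (flyped c r v s K) c (r + 2) v (s + 2)"
    using assms(2) cv by (auto simp: stacked_def exchange_def algebra_simps mod_four)
  \<comment> \<open>Only the difference \<open>s - r\<close> enters \<open>exchange\<close>.\<close>
  show "exchange c (r + 2) v (s + 2) = exchange c r v s"
    by (auto simp: exchange_def fun_eq_iff)
qed

section \<open>Curves of a state under the move\<close>

text \<open>A map from the ends of \<open>K\<close> to those of the flyped diagram is built for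
  \<open>orbit_count_le\<close>. It is \<open>exchange\<close> except at the four inner ends, whose
  images depend on how \<open>c\<close> is smoothed.\<close>

lemma orbit_count_flyped_le:
  fixes K :: "'c vlink"
  assumes K: "matched K" and st: "stacked K c r v s"
  shows "orbit_count (darts K) {mate (flyped c r v s K), state_join K S}
      \<le> orbit_count (darts K) {mate K, state_join K S}"
proof -
  define e where "e = exchange c r v s"
  define L where "L = flyped c r v s K"
  define j where "j = state_join K S"
  define R where "R = {(y, f y) | y f. y \<in> darts K \<and> f \<in> {mate L, j}}"
  have cv: "c \<noteq> v" "c \<in> crossings K" "v \<in> crossings K" "v \<in> virtuals K" "c \<notin> virtuals K"
    and m1: "mate K (c, r + 1) = (v, s)" "mate K (c, r + 2) = (v, s + 3)"
    using st K by (auto simp: stacked_def classicals_def matched_def)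
  have dart: "(c, i) \<in> darts K" "(v, i) \<in> darts K" for i using cv by (simp_all add: darts_def)
  have mm: "mate K d \<in> darts K" "mate K (mate K d) = d" if "d \<in> darts K" for d
    using K that by (auto simp: matched_def)
  have m2: "mate K (v, s) = (c, r + 1)" "mate K (v, s + 3) = (c, r + 2)"
    using m1 mm(2) dart by metis+
  have e: "e (c, i) = (v, i - r + s)" "e (v, i) = (c, i - s + r)" for i
    using cv by (auto simp: e_def exchange_def)
  have es: "e (c, r) = (v, s)" "e (c, r + 1) = (v, s + 1)" "e (c, r + 2) = (v, s + 2)"
    "e (c, r + 3) = (v, s + 3)" "e (v, s) = (c, r)" "e (v, s + 1) = (c, r + 1)"
    "e (v, s + 2) = (c, r + 2)" "e (v, s + 3) = (c, r + 3)"
    by (simp_all add: e algebra_simps)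
  have ee: "e (e d) = d" for d using cv exchange_involution by (simp add: e_def)
  have eD: "e d \<in> darts K" if "d \<in> darts K" for d
    using exchange_in_darts[OF cv(2,3) that] by (simp add: e_def)
  have mL: "mate L d = e (mate K (e d))" for d by (simp add: L_def e_def)
  have L: "matched L" "darts L = darts K"
    using matched_flyped[OF K] cv by (auto simp: L_def)
  have jv: "j (v, i) = (v, i + 2)" for i using cv by (simp add: j_def state_join_def turn_def)
  have jo: "fst (j d) = fst d" for d by (auto simp: j_def state_join_def turn_def)
  have inv: "f y \<in> darts K \<and> f (f y) = y" if "y \<in> darts K" "f \<in> {mate L, j}" for y f
    using that L state_join_involution[of y K S] by (auto simp: matched_def j_def)
  have symR: "sym (R\<^sup>*)"
    unfolding R_def by (rule sym_rtrancl_involutions) (use inv in auto)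
  have stepm: "(d, mate L d) \<in> R\<^sup>*" if "d \<in> darts K" for d
    unfolding R_def using that by (intro r_into_rtrancl) blast
  have stepj: "(d, j d) \<in> R\<^sup>*" if "d \<in> darts K" for d
    unfolding R_def using that by (intro r_into_rtrancl) blast
  \<comment> \<open>In \<open>L\<close> the virtual crossing is on top: the outer top ends
    \<open>(v, s)\<close> and \<open>(v, s + 3)\<close> run straight through it and reach the
    opposite top ends of \<open>c\<close>.\<close>
  have a1: "((v, s), (v, s + 2)) \<in> R\<^sup>*" "((v, s + 3), (v, s + 1)) \<in> R\<^sup>*"
    using stepj[OF dart(2)[of s]] stepj[OF dart(2)[of "s + 3"]] by (simp_all add: jv add.assoc mod_four)
  have a2: "((v, s + 2), (c, r + 3)) \<in> R\<^sup>*" "((v, s + 1), (c, r)) \<in> R\<^sup>*"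
    using stepm[OF dart(2)[of "s + 2"]] stepm[OF dart(2)[of "s + 1"]]
    by (simp_all add: mL es m1)
  note a3 = rtrancl_trans[OF a1(1) a2(1)] rtrancl_trans[OF a1(2) a2(2)]
  define inner where "inner = {(c, r + 1), (c, r + 2), (v, s), (v, s + 3)}"
  have m_inner: "mate K d \<in> inner" if "d \<in> inner" for d
    using that m1 m2 by (auto simp: inner_def)
  \<comment> \<open>Only the inner ends of \<open>L\<close> can be missed by \<open>h\<close>, and
    \<open>a1\<close> and \<open>a3\<close> place each of them on the curve of an outer top
    end.\<close>
  have surj: "\<exists>x\<in>darts K. (h x, y) \<in> R\<^sup>*"
    if h: "\<And>d. d \<notin> inner \<Longrightarrow> h d = e d" and y: "y \<in> darts K" for h :: "'c dart \<Rightarrow> 'c dart" and y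
  proof (cases "e y \<in> inner")
    case False
    then have "h (e y) = y" "e y \<in> darts K"
      using h ee y eD by simp_all
    then show ?thesis by (intro bexI[of _ "e y"]) simp_all
  next
    case True
    then have "e (e y) \<in> e ` inner" by blast
    then consider "y = (v, s + 1)" | "y = (v, s + 2)" | "y = (c, r)" | "y = (c, r + 3)"
      by (auto simp: ee es inner_def)
    moreover have "h (c, r) = (v, s)" "h (c, r + 3) = (v, s + 3)"
      using cv by (auto simp: h es inner_def)
    ultimately show ?thesis using a1 a3 dart by metis
  qed
  \<comment> \<open>\<open>h\<close> lets the outer ends of the tangle keep their places in the plane and sends the inner
      ends of \<open>K\<close> to any end of \<open>L\<close> that lies on the same curve.\<close>
  have count: "orbit_count (darts K) {mate L, j} \<le> orbit_count (darts K) {mate K, j}"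
    if h: "\<And>d. d \<notin> inner \<Longrightarrow> h d = e d"
      and hm: "\<And>d. d \<in> inner \<Longrightarrow> (h d, h (mate K d)) \<in> R\<^sup>*"
      and hj: "\<And>i. (h (c, i), h (j (c, i))) \<in> R\<^sup>*" "\<And>i. (h (v, i), h (j (v, i))) \<in> R\<^sup>*"
    for h :: "'c dart \<Rightarrow> 'c dart"
  proof (rule orbit_count_le[where h = h])
    show "finite (darts K)" using K by (simp add: matched_def darts_def)
  next
    fix x f assume x: "x \<in> darts K" and "f \<in> {mate K, j}"
    then consider "f = mate K" | "f = j" by auto
    then have "(h x, h (f x)) \<in> R\<^sup>*"
    proof cases
      case 1
      show ?thesis
      proof (cases "x \<in> inner")
        case True
        then show ?thesis using 1 hm by simp
      next
        case False
        then have "mate K x \<notin> inner" using m_inner mm(2)[OF x] by metis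
        then have "h (mate K x) = mate L (h x)" using False by (simp add: h mL ee)
        moreover have "h x \<in> darts K"
          using False x h eD by simp
        ultimately show ?thesis using 1 stepm by simp
      qed
    next
      case 2
      show ?thesis
      proof (cases "fst x = c \<or> fst x = v")
        case True
        then show ?thesis using 2 hj by (cases x) auto
      next
        \<comment> \<open>Away from the tangle \<open>exchange\<close> is the identity and the joins
          are unchanged.\<close>
        case False
        then have "x \<notin> inner" "j x \<notin> inner" "e x = x" "e (j x) = j x"
          by (auto simp: inner_def e_def exchange_def jo dest!: arg_cong[where f = fst])
        then show ?thesis using 2 h stepj[OF x] by simp
      qed
    qed
    then show "(h x, h (f x)) \<in> {(y, f y) | y f. y \<in> darts K \<and> f \<in> {mate L, j}}\<^sup>*"
      by (simp add: R_def)
  qed (use inv surj[of h] h in \<open>auto simp: R_def\<close>)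
  define \<sigma> where "\<sigma> = (if c \<in> S then A_smooth else B_smooth)"
  have jc: "j (c, i) = (c, \<sigma> i)" for i using cv by (simp add: j_def state_join_def \<sigma>_def)
  \<comment> \<open>This enumerates the ends of a crossing from the corner \<open>r\<close> or
    \<open>s\<close> of the tangle instead of from 0.\<close>
  have four: "P i" if "P t" "P (t + 1)" "P (t + 2)" "P (t + 3)" for P and i t :: 4
    using that exhaust_four[of "i - t"] by (auto simp: diff_eq_eq add.commute)
  have ne: "c \<noteq> v" "v \<noteq> c" using cv by auto
  consider "vertical \<sigma> r" | "horizontal \<sigma> r"
    using smooth_cases[of r] unfolding \<sigma>_def by (cases "c \<in> S") auto
  then have "orbit_count (darts K) {mate L, j} \<le> orbit_count (darts K) {mate K, j}"
  proof cases
    case 1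
    \<comment> \<open>The smoothed tangle of \<open>L\<close> joins diagonally opposite corners, as
      it does in \<open>K\<close>.\<close>
    have b: "((v, s), (c, r + 2)) \<in> R\<^sup>*" "((v, s + 3), (c, r + 1)) \<in> R\<^sup>*"
      using a3 stepj[OF dart(1)[of "r + 3"]] stepj[OF dart(1)[of r]] 1
      by (auto simp: jc vertical_def intro: rtrancl_trans)
    \<comment> \<open>In \<open>K\<close> the left inner ends lie on the curve of the top left
      corner and the right ones on that of the top right corner, so they go to the places of these
      corners in \<open>L\<close>.\<close>
    define h where "h d = (if d = (c, r + 1) \<or> d = (v, s) then (v, s)
        else if d = (c, r + 2) \<or> d = (v, s + 3) then (v, s + 3) else e d)" for d
    have hs: "h (c, r) = (v, s)" "h (c, r + 1) = (v, s)" "h (c, r + 2) = (v, s + 3)"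
      "h (c, r + 3) = (v, s + 3)" "h (v, s) = (v, s)" "h (v, s + 1) = (c, r + 1)"
      "h (v, s + 2) = (c, r + 2)" "h (v, s + 3) = (v, s + 3)"
      using ne by (auto simp: h_def es)
    show ?thesis
    proof (rule count[of h])
      show "(h (c, i), h (j (c, i))) \<in> R\<^sup>*" for i
        by (rule four[where t = r]) (use 1 in \<open>simp_all add: jc vertical_def hs\<close>)
      show "(h (v, i), h (j (v, i))) \<in> R\<^sup>*" for i
        by (rule four[where t = s]) (use b b[THEN symD[OF symR]] in \<open>simp_all add: jv hs add.assoc mod_four\<close>)
    qed (auto simp: h_def inner_def m1 m2 split: if_splits)
  next
    case 2
    have b: "((c, r + 1), (c, r + 2)) \<in> R\<^sup>*"
      using stepj[OF dart(1)[of "r + 1"]] 2 by (auto simp: jc horizontal_def)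
    have "((c, r + 3), (c, r)) \<in> R\<^sup>*"
      using stepj[OF dart(1)[of "r + 3"]] 2 by (auto simp: jc horizontal_def)
    \<comment> \<open>The cap at \<open>c\<close> closes up through \<open>v\<close>, which joins
      the two outer top ends of \<open>L\<close>.\<close>
    then have t: "((v, s), (v, s + 3)) \<in> R\<^sup>*"
      using a3 symD[OF symR] by (blast intro: rtrancl_trans)
    \<comment> \<open>Here all four inner ends of \<open>K\<close> lie on the arc joining the two
      bottom corners; \<open>(c, r + 1)\<close> is the bottom left corner in
      \<open>L\<close>.\<close>
    define h where "h d = (if d \<in> inner then (c, r + 1) else e d)" for d
    have hs: "h (c, r) = (v, s)" "h (c, r + 1) = (c, r + 1)" "h (c, r + 2) = (c, r + 1)"
      "h (c, r + 3) = (v, s + 3)" "h (v, s) = (c, r + 1)" "h (v, s + 1) = (c, r + 1)"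
      "h (v, s + 2) = (c, r + 2)" "h (v, s + 3) = (c, r + 1)"
      using ne by (auto simp: h_def es inner_def)
    show ?thesis
    proof (rule count[of h])
      show "(h (c, i), h (j (c, i))) \<in> R\<^sup>*" for i
        by (rule four[where t = r]) (use 2 t t[THEN symD[OF symR]] in \<open>simp_all add: jc horizontal_def hs\<close>)
      show "(h (v, i), h (j (v, i))) \<in> R\<^sup>*" for i
        by (rule four[where t = s]) (use b b[THEN symD[OF symR]] in \<open>simp_all add: jv hs add.assoc mod_four\<close>)
    qed (use m_inner in \<open>auto simp: h_def\<close>)
  qed
  then show ?thesis by (simp add: L_def j_def)
qed

text \<open>The reverse inequality is the same estimate applied to the flyped diagram, whose tangle
  seen upside down flypes back to \<open>K\<close>.\<close>

lemma state_curves_flyped: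
  assumes K: "matched K" and st: "stacked K c r v s"
  shows "state_curves (flyped c r v s K) S = state_curves K S"
proof -
  let ?L = "flyped c r v s K"
  have cv: "c \<noteq> v" "c \<in> crossings K" "v \<in> crossings K"
    using st K by (auto simp: stacked_def classicals_def matched_def)
  have "flyped c (r + 2) v (s + 2) ?L = K"
    using flyped_flyped[OF cv(1)] stacked_flyped(2)[OF K st] by (simp add: flyped_def)
  then have "orbit_count (darts K) {mate K, state_join K S}
      \<le> orbit_count (darts K) {mate ?L, state_join K S}"
    using orbit_count_flyped_le[OF matched_flyped[OF K cv(2,3,1)] stacked_flyped(1)[OF K st], of S]
    by simp
  with orbit_count_flyped_le[OF K st, of S] show ?thesis
    by (simp add: state_curves_def)
qed

lemma bracket_flyped:
  assumes "matched K" "stacked K c r v s"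
  shows "bracket (flyped c r v s K) = bracket K"
  by (simp add: bracket_def state_curves_flyped[OF assms])

section \<open>Writhe under the move\<close>

text \<open>The virtual crossing swaps the two strands, so the directions at the ends of
  \<open>c\<close> are mirrored left to right: \<open>r\<close> trades with \<open>r + 3\<close> and
  \<open>r + 1\<close> with \<open>r + 2\<close>. The sign compares ends 1 and 2; the mirror either
  swaps these two values or swaps and negates both, so the comparison is unaffected.\<close>

lemma writhe_flyped:
  assumes K: "virtual_link_diagram K" and st: "stacked K c r v s"
  shows "writhe (flyped c r v s K) = writhe K"
proof -
  have cv: "c \<noteq> v" "c \<in> crossings K" "v \<in> crossings K" "v \<in> virtuals K"
    and m: "mate K (c, r + 1) = (v, s)" "mate K (c, r + 2) = (v, s + 3)"
    using st K by (auto simp: stacked_def classicals_def virtual_link_diagram_def)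
  have dart: "(c, i) \<in> darts K" "(v, i) \<in> darts K" for i using cv by (simp_all add: darts_def)
  have ends: "mate K d \<in> outs K \<longleftrightarrow> d \<notin> outs K" if "d \<in> darts K" for d
    using K that by (simp add: virtual_link_diagram_def)
  have half: "(x, i + 2) \<in> outs K \<longleftrightarrow> (x, i) \<notin> outs K" if "x \<in> crossings K" for x i
    using K that by (auto simp: virtual_link_diagram_def turn_def darts_def)
  have "(v, s) \<in> outs K \<longleftrightarrow> (c, r + 1) \<notin> outs K" "(v, s + 3) \<in> outs K \<longleftrightarrow> (c, r + 2) \<notin> outs K"
    using ends[OF dart(1), of "r + 1"] ends[OF dart(1), of "r + 2"] m by simp_all
  \<comment> \<open>All directions at \<open>v\<close> are expressed by those at the two lower ends
    of \<open>c\<close>, since \<open>exchange\<close> moves them onto \<open>c\<close>.\<close>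
  then have v: "(v, s) \<in> outs K \<longleftrightarrow> (c, r + 1) \<notin> outs K" "(v, s + 1) \<in> outs K \<longleftrightarrow> (c, r + 2) \<in> outs K"
    "(v, s + 2) \<in> outs K \<longleftrightarrow> (c, r + 1) \<in> outs K" "(v, s + 3) \<in> outs K \<longleftrightarrow> (c, r + 2) \<notin> outs K"
    using half[OF cv(3), of s] half[OF cv(3), of "s + 1"] by (auto simp: add.assoc)
  let ?L = "flyped c r v s K"
  have out: "d \<in> outs ?L \<longleftrightarrow> exchange c r v s d \<in> outs K" for d
  proof
    show "exchange c r v s d \<in> outs K" if "d \<in> outs ?L"
      using that by (auto simp: exchange_involution[OF cv(1)])
    show "d \<in> outs ?L" if "exchange c r v s d \<in> outs K"
      using imageI[OF that, of "exchange c r v s"] by (simp add: exchange_involution[OF cv(1)])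
  qed
  have "crossing_sign ?L x = crossing_sign K x" if "x \<in> classicals K" for x
  proof (cases "x = c")
    case True
    have "(c, r + 3) \<in> outs K \<longleftrightarrow> (c, r + 1) \<notin> outs K" "(c, r) \<in> outs K \<longleftrightarrow> (c, r + 2) \<notin> outs K"
      using half[OF cv(2), of r] half[OF cv(2), of "r + 1"] by (auto simp: add.assoc)
    moreover have "(c, r) \<in> outs ?L \<longleftrightarrow> (c, r + 1) \<notin> outs K" "(c, r + 1) \<in> outs ?L \<longleftrightarrow> (c, r + 2) \<in> outs K"
      "(c, r + 2) \<in> outs ?L \<longleftrightarrow> (c, r + 1) \<in> outs K" "(c, r + 3) \<in> outs ?L \<longleftrightarrow> (c, r + 2) \<notin> outs K"
      unfolding out using v by (simp_all add: exchange_def add.commute[of _ s])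
    moreover note exhaust_four[of r]
    ultimately show ?thesis
      unfolding crossing_sign_def True by (elim disjE) (simp_all add: mod_four del: flyped_simps)
  next
    case False
    moreover have "x \<noteq> v" using that cv by (auto simp: classicals_def)
    ultimately show ?thesis by (simp add: crossing_sign_def out exchange_def del: flyped_simps)
  qed
  then show ?thesis by (simp add: writhe_def)
qed

section \<open>Both directions of the move\<close>

text \<open>An inverse move from \<open>K\<close> is itself a forward move on the tangle seen upside
  down, so only forward moves remain to be considered.\<close>

lemma flype_stepE:
  assumes K: "matched K" and step: "flype_step K L \<or> flype_step L K"
  obtains c r v s where "stacked K c r v s" "L = flyped c r v s K" "matched L"
  using step
proof
  assume "flype_step K L"
  then obtain c r v s where st: "stacked K c r v s" and L: "L = flyped c r v s K"
    by (auto simp: flype_step_def flyped_def)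
  moreover have "c \<noteq> v" "c \<in> crossings K" "v \<in> crossings K"
    using st K by (auto simp: stacked_def classicals_def matched_def)
  ultimately have "matched L" using matched_flyped[OF K] by simp
  with st L that show ?thesis by blast
next
  assume "flype_step L K"
  then obtain c r v s where st: "stacked L c r v s" and KL: "K = flyped c r v s L"
    by (auto simp: flype_step_def flyped_def)
  have cv: "c \<noteq> v" "c \<in> crossings K" "v \<in> crossings K"
    using st K KL by (auto simp: stacked_def classicals_def matched_def)
  have L: "L = flyped c r v s K" unfolding KL by (rule flyped_flyped[OF cv(1), symmetric])
  then have mL: "matched L" using matched_flyped[OF K cv(2,3,1)] by simp
  have "stacked K c (r + 2) v (s + 2)"
    unfolding KL by (rule stacked_flyped(1)[OF mL st])
  moreover have "L = flyped c (r + 2) v (s + 2) K"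
    using L unfolding flyped_def stacked_flyped(2)[OF mL st] .
  ultimately show ?thesis using mL that by blast
qed

section \<open>Renaming crossings and their ends\<close>

text \<open>The renaming gives a bijection of ends that respects arcs and joins, and states
  correspond under \<open>g\<close>. For the writhe, a shift by 2 reverses the directions at both
  ends compared by the sign.\<close>

lemma
  assumes K: "matched K" and K': "virtual_link_diagram K'" and same: "same_diagram K K'"
  shows bracket_same_diagram: "bracket K = bracket K'"
    and writhe_same_diagram: "writhe K = writhe K'"
proof -
  obtain g k where g: "bij_betw g (crossings K) (crossings K')" "g ` virtuals K = virtuals K'"
    and k: "\<And>c. c \<in> classicals K \<Longrightarrow> k c = 0 \<or> k c = 2"
    and mate: "\<And>c i c' i'. (c, i) \<in> darts K \<Longrightarrow> (c', i') \<in> darts K \<Longrightarrow>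
        mate K (c, i) = (c', i') \<longleftrightarrow> mate K' (g c, i + k c) = (g c', i' + k c')"
    and outs: "\<And>c i. (c, i) \<in> darts K \<Longrightarrow> (c, i) \<in> outs K \<longleftrightarrow> (g c, i + k c) \<in> outs K'"
    and free: "free_circles K = free_circles K'"
    using same unfolding same_diagram_def by fast
  have vK: "virtuals K \<subseteq> crossings K" "finite (crossings K)" using K by (auto simp: matched_def)
  have inj: "inj_on g (crossings K)" and img: "g ` crossings K = crossings K'"
    using g(1) by (auto simp: bij_betw_def)
  have cl: "g ` classicals K = classicals K'"
    using inj_on_image_set_diff[OF inj, of "crossings K" "virtuals K"] img g(2) vK
    by (simp add: classicals_def)
  have injc: "inj_on g (classicals K)" using inj by (auto simp: classicals_def intro: inj_on_subset)
  have clK: "classicals K \<subseteq> crossings K" by (auto simp: classicals_def)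
  define h where "h d = (g (fst d), snd d + k (fst d))" for d
  have "inj_on h (darts K)"
    using inj by (auto simp: h_def inj_on_def darts_def)
  moreover have "h ` darts K = darts K'"
  proof
    show "h ` darts K \<subseteq> darts K'" using img by (auto simp: h_def darts_def)
    show "darts K' \<subseteq> h ` darts K"
    proof
      fix d assume "d \<in> darts K'"
      then have "fst d \<in> g ` crossings K" using img by (auto simp: darts_def)
      then obtain c where "c \<in> crossings K" "fst d = g c"
        by blast
      then have "(c, snd d - k c) \<in> darts K" "d = h (c, snd d - k c)"
        by (auto simp: h_def darts_def prod_eq_iff)
      then show "d \<in> h ` darts K" by blast
    qed
  qed
  ultimately have h: "bij_betw h (darts K) (darts K')" by (simp add: bij_betw_def)
  have virt: "g c \<in> virtuals K' \<longleftrightarrow> c \<in> virtuals K" if "c \<in> crossings K" for c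
    using that inj_on_image_mem_iff[OF inj that vK(1)] g(2) by simp
  have curves: "state_curves K S = state_curves K' (g ` S)" if S: "S \<subseteq> classicals K" for S
  proof -
    have "orbit_count (darts K) {mate K, state_join K S}
        = orbit_count (darts K') {mate K', state_join K' (g ` S)}"
    proof (rule orbit_count_bij_betw[OF _ h])
      show "finite (darts K)" using vK by (simp add: darts_def)
      show "mate K x \<in> darts K \<and> mate K (mate K x) = x" if "x \<in> darts K" for x
        using K that by (simp add: matched_def)
      show "state_join K S x \<in> darts K \<and> state_join K S (state_join K S x) = x" if "x \<in> darts K" for x
        using state_join_involution[OF that] .
      show "h (mate K x) = mate K' (h x)" if "x \<in> darts K" for x
      proof -
        have "mate K x \<in> darts K" using K that by (simp add: matched_def)
        then show ?thesis
          using mate[of "fst x" "snd x" "fst (mate K x)" "snd (mate K x)"] that by (simp add: h_def)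
      qed
      show "h (state_join K S x) = state_join K' (g ` S) (h x)" if D: "x \<in> darts K" for x
      proof -
        obtain c i where x: "x = (c, i)" "c \<in> crossings K"
          using D by (cases x) (auto simp: darts_def)
        have "g c \<in> g ` S \<longleftrightarrow> c \<in> S"
          using inj_on_image_mem_iff[OF inj x(2)] S clK by blast
        moreover have "k c = 0 \<or> k c = 2" if "c \<notin> virtuals K"
          using that x k by (simp add: classicals_def)
        ultimately show ?thesis
          using x virt[OF x(2)] smooth_half_turn[of i]
          by (auto simp: h_def state_join_def turn_def)
      qed
    qed
    then show ?thesis by (simp add: state_curves_def free)
  qed
  \<comment> \<open>Reindexing the state sum by images under \<open>g\<close> matches the two
    brackets term by term.\<close>
  have "bij_betw (image g) (Pow (classicals K)) (Pow (classicals K'))"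
    using injc cl by (intro bij_betw_Pow) (simp add: bij_betw_def)
  then have "bracket K' = (\<Sum>S \<in> Pow (classicals K).
      A_pow 1 ^ card (g ` S) * A_pow (- 1) ^ card (classicals K' - g ` S) * delta ^ state_curves K' (g ` S))"
    unfolding bracket_def by (rule sum.reindex_bij_betw[symmetric])
  also have "\<dots> = bracket K"
    unfolding bracket_def
  proof (rule sum.cong)
    fix S assume "S \<in> Pow (classicals K)"
    then have S: "S \<subseteq> classicals K" by simp
    have "classicals K' - g ` S = g ` (classicals K - S)"
      using inj_on_image_set_diff[OF injc, of "classicals K" S] S cl by auto
    moreover have "card (g ` S) = card S" "card (g ` (classicals K - S)) = card (classicals K - S)"
      using S injc by (auto intro!: card_image intro: inj_on_subset)
    ultimately show "A_pow 1 ^ card (g ` S) * A_pow (- 1) ^ card (classicals K' - g ` S)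
          * delta ^ state_curves K' (g ` S)
        = A_pow 1 ^ card S * A_pow (- 1) ^ card (classicals K - S) * delta ^ state_curves K S"
      using curves[OF S] by simp
  qed simp
  finally show "bracket K = bracket K'" by simp
  have half: "(x, i + 2) \<in> outs K' \<longleftrightarrow> (x, i) \<notin> outs K'" if "x \<in> crossings K'" for x i
    using K' that by (auto simp: virtual_link_diagram_def turn_def darts_def)
  have "crossing_sign K' (g c) = crossing_sign K c" if "c \<in> classicals K" for c
  proof -
    have "c \<in> crossings K" "g c \<in> crossings K'" using that img by (auto simp: classicals_def)
    then show ?thesis
      \<comment> \<open>If \<open>k c = 2\<close>, ends 1 and 2 become 3 and 0, whose directions are
        opposite to those at 1 and 2.\<close>
      using k[OF that] outs[of c 1] outs[of c 2] half[of "g c" 1] half[of "g c" 2]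
      by (auto simp: crossing_sign_def darts_def)
  qed
  then have "(\<Sum>c\<in>classicals K. crossing_sign K c) = (\<Sum>c\<in>classicals K. crossing_sign K' (g c))"
    by simp
  also have "\<dots> = (\<Sum>c\<in>classicals K'. crossing_sign K' c)"
    using injc by (simp add: sum.reindex flip: cl)
  finally show "writhe K = writhe K'" by (simp add: writhe_def)
qed

theorem theorem2p4:
  fixes K :: "'c vlink" and K' :: "'d vlink"
  assumes "virtual_link_diagram K" and "virtual_link_diagram K'"
    and "flype K K'"
  shows "normalized_bracket K = normalized_bracket K'"
proof -
  obtain L where step: "flype_step K L \<or> flype_step L K" and same: "same_diagram L K'"
    using assms(3) by (auto simp: flype_def)
  have K: "matched K" using assms(1) by (simp add: virtual_link_diagram_def matched_def)
  obtain c r v s where st: "stacked K c r v s" and L: "L = flyped c r v s K" "matched L"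
    using flype_stepE[OF K step] .
  have "bracket K = bracket K'"
    using bracket_flyped[OF K st] bracket_same_diagram[OF L(2) assms(2) same] L(1) by simp
  moreover have "writhe K = writhe K'"
    using writhe_flyped[OF assms(1) st] writhe_same_diagram[OF L(2) assms(2) same] L(1) by simp
  ultimately show ?thesis by (simp add: normalized_bracket_def)
qed

end
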